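(* Let $G=(V,E)$ be a directed graph with positive real capacities $w$, a designated source vertex $s$ and a designated sink vertex $t$. Let $C$ be an $(s,t)$-cut and let $e=(u,v)$ be a vital edge that contributes to $C$. Then $C$ is a mincut for $e$ if and only if there is a maximum $(s,t)$-flow $f$ in $G$ such that (1) $f_{in}(C)=0$, and (2) $f(e)=w_{min}(e)$ and every other contributing edge $e'$ of $C$ satisfies $f(e')=w(e')$.
   Context: An $(s,t)$-cut is a set $C\subset V$ with $s\in C$, $t\notin C$; an edge $(x,y)$ contributes to $C$ if $x\in C$, $y\notin C$; $c(C)$ is the total capacity of contributing edges; $f^*$ is the minimum capacity of an $(s,t)$-cut. An edge is vital if its removal strictly decreases the minimum $(s,t)$-cut capacity; for an edge $e$, $w_{min}(e)$ is the amount by which the minimum $(s,t)$-cut capacity decreases when $e$ is removed. A mincut for edge $e$ is an $(s,t)$-cut to which $e$ contributes of minimum capacity among all $(s,t)$-cuts to which $e$ contributes. For an $(s,t)$-flow $f$, $f_{in}(C)$ is the total flow on edges going from $V\setminus C$ into $C$. *)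

theory Defs
  imports "HOL-Analysis.Analysis" "Graph_Theory.Digraph"
begin

definition st_cut :: "('a, 'b) pre_digraph \<Rightarrow> 'a \<Rightarrow> 'a \<Rightarrow> 'a set \<Rightarrow> bool" where
  "st_cut G s t C \<longleftrightarrow> C \<subseteq> verts G \<and> s \<in> C \<and> t \<notin> C"

definition contributing_arcs :: "('a, 'b) pre_digraph \<Rightarrow> 'a set \<Rightarrow> 'b set" where
  "contributing_arcs G C = {e \<in> arcs G. tail G e \<in> C \<and> head G e \<notin> C}"

definition cut_capacity :: "('a, 'b) pre_digraph \<Rightarrow> ('b \<Rightarrow> real) \<Rightarrow> 'a set \<Rightarrow> real" where
  "cut_capacity G w C = (\<Sum>e\<in>contributing_arcs G C. w e)"

text \<open>The minimum is meaningful for finite vertex sets containing distinct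
  \<open>s\<close> and \<open>t\<close>: the set of cuts is then finite and contains \<open>{s}\<close>.\<close>

definition mincut_capacity ::
  "('a, 'b) pre_digraph \<Rightarrow> ('b \<Rightarrow> real) \<Rightarrow> 'a \<Rightarrow> 'a \<Rightarrow> real" where
  "mincut_capacity G w s t = Min (cut_capacity G w ` {C. st_cut G s t C})"

definition vital ::
  "('a, 'b) pre_digraph \<Rightarrow> ('b \<Rightarrow> real) \<Rightarrow> 'a \<Rightarrow> 'a \<Rightarrow> 'b \<Rightarrow> bool" where
  "vital G w s t e \<longleftrightarrow>
     e \<in> arcs G \<and> mincut_capacity (pre_digraph.del_arc G e) w s t < mincut_capacity G w s t"

definition w_min ::
  "('a, 'b) pre_digraph \<Rightarrow> ('b \<Rightarrow> real) \<Rightarrow> 'a \<Rightarrow> 'a \<Rightarrow> 'b \<Rightarrow> real" where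
  "w_min G w s t e = mincut_capacity G w s t - mincut_capacity (pre_digraph.del_arc G e) w s t"

definition mincut_for ::
  "('a, 'b) pre_digraph \<Rightarrow> ('b \<Rightarrow> real) \<Rightarrow> 'a \<Rightarrow> 'a \<Rightarrow> 'b \<Rightarrow> 'a set \<Rightarrow> bool" where
  "mincut_for G w s t e C \<longleftrightarrow>
     st_cut G s t C \<and> e \<in> contributing_arcs G C \<and>
     (\<forall>C'. st_cut G s t C' \<and> e \<in> contributing_arcs G C' \<longrightarrow>
           cut_capacity G w C \<le> cut_capacity G w C')"

definition st_flow ::
  "('a, 'b) pre_digraph \<Rightarrow> ('b \<Rightarrow> real) \<Rightarrow> 'a \<Rightarrow> 'a \<Rightarrow> ('b \<Rightarrow> real) \<Rightarrow> bool" where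
  "st_flow G w s t f \<longleftrightarrow>
     (\<forall>e\<in>arcs G. 0 \<le> f e \<and> f e \<le> w e) \<and>
     (\<forall>v\<in>verts G - {s, t}. (\<Sum>e\<in>in_arcs G v. f e) = (\<Sum>e\<in>out_arcs G v. f e))"

text \<open>Arcs may enter the source, so the value is the net flow out of it.\<close>

definition flow_value :: "('a, 'b) pre_digraph \<Rightarrow> 'a \<Rightarrow> ('b \<Rightarrow> real) \<Rightarrow> real" where
  "flow_value G s f = (\<Sum>e\<in>out_arcs G s. f e) - (\<Sum>e\<in>in_arcs G s. f e)"

definition max_st_flow ::
  "('a, 'b) pre_digraph \<Rightarrow> ('b \<Rightarrow> real) \<Rightarrow> 'a \<Rightarrow> 'a \<Rightarrow> ('b \<Rightarrow> real) \<Rightarrow> bool" where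
  "max_st_flow G w s t f \<longleftrightarrow>
     st_flow G w s t f \<and> (\<forall>g. st_flow G w s t g \<longrightarrow> flow_value G s g \<le> flow_value G s f)"

definition flow_in :: "('a, 'b) pre_digraph \<Rightarrow> ('b \<Rightarrow> real) \<Rightarrow> 'a set \<Rightarrow> real" where
  "flow_in G f C = (\<Sum>e | e \<in> arcs G \<and> tail G e \<in> verts G - C \<and> head G e \<in> C. f e)"

end

theory Submission
  imports Defs
begin

text \<open>
  Deleting \<open>e\<close> lowers exactly the cuts to which \<open>e\<close> contributes, each by \<open>w e\<close>. As \<open>e\<close> is
  vital, a minimum cut of the graph without \<open>e\<close> is therefore a mincut for \<open>e\<close>, and the mincuts
  for \<open>e\<close> are the cuts \<open>C\<close> through \<open>e\<close> with \<open>c(C) = f\<^sup>* - w\<^sub>m\<^sub>i\<^sub>n(e) + w(e)\<close>. Such a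
  \<open>C\<close> is precisely a minimum cut, of capacity \<open>f\<^sup>*\<close>, once the capacity of \<open>e\<close> is lowered to
  \<open>w\<^sub>m\<^sub>i\<^sub>n(e)\<close>, and a maximum flow for the lowered capacity saturates \<open>C\<close>.

  The max-flow min-cut theorem for real capacities is obtained without augmenting paths: a
  maximum flow exists by compactness, and the set of all vertices to which a unit can be
  routed from \<open>s\<close> along a feasible direction at this flow is a saturated cut.
\<close>

section \<open>Net outflow and flow across a cut\<close>

definition net_out :: "('a, 'b) pre_digraph \<Rightarrow> ('b \<Rightarrow> real) \<Rightarrow> 'a \<Rightarrow> real" where
  "net_out G f x = (\<Sum>a\<in>out_arcs G x. f a) - (\<Sum>a\<in>in_arcs G x. f a)"

lemma flow_value_eq_net_out: "flow_value G s f = net_out G f s"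
  by (simp add: flow_value_def net_out_def)

lemma st_flow_iff_net_out:
  "st_flow G w s t f \<longleftrightarrow>
     (\<forall>a\<in>arcs G. 0 \<le> f a \<and> f a \<le> w a) \<and> (\<forall>v\<in>verts G - {s, t}. net_out G f v = 0)"
proof -
  have "net_out G f v = 0 \<longleftrightarrow> (\<Sum>a\<in>in_arcs G v. f a) = (\<Sum>a\<in>out_arcs G v. f a)" for v
    by (auto simp: net_out_def)
  then show ?thesis
    by (simp add: st_flow_def)
qed

text \<open>For \<open>f\<close> within the capacity bounds these are the directions in which a
  small positive step keeps the bounds; conservation is left aside.\<close>

definition feasible_direction ::
  "('a, 'b) pre_digraph \<Rightarrow> ('b \<Rightarrow> real) \<Rightarrow> ('b \<Rightarrow> real) \<Rightarrow> ('b \<Rightarrow> real) \<Rightarrow> bool" where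
  "feasible_direction G w f d \<longleftrightarrow>
     (\<forall>a\<in>arcs G. (0 < d a \<longrightarrow> f a < w a) \<and> (d a < 0 \<longrightarrow> 0 < f a))"

text \<open>\<open>d\<close> is a unit flow from \<open>s\<close> to \<open>v\<close> in the
  residual network and replaces a residual path. For \<open>v = s\<close> the indicators cancel, so
  the zero direction is a witness.\<close>

definition residual_cut ::
  "('a, 'b) pre_digraph \<Rightarrow> ('b \<Rightarrow> real) \<Rightarrow> 'a \<Rightarrow> ('b \<Rightarrow> real) \<Rightarrow> 'a set" where
  "residual_cut G w s f = {v \<in> verts G. \<exists>d. feasible_direction G w f d \<and>
     (\<forall>x. net_out G d x = of_bool (x = s) - of_bool (x = v))}"

context fin_digraph
begin

text \<open>A sum over one arc set independent of \<open>x\<close> exposes linearity and continuity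
  in \<open>f\<close> and lets sums over vertices be swapped with sums over arcs.\<close>

lemma net_out_alt:
  "net_out G f x = (\<Sum>a\<in>arcs G. f a * (of_bool (tail G a = x) - of_bool (head G a = x)))"
proof -
  have "(\<Sum>a\<in>out_arcs G x. f a) = (\<Sum>a\<in>arcs G. f a * of_bool (tail G a = x))"
    by (rule sum.mono_neutral_cong_left) auto
  moreover have "(\<Sum>a\<in>in_arcs G x. f a) = (\<Sum>a\<in>arcs G. f a * of_bool (head G a = x))"
    by (rule sum.mono_neutral_cong_left) auto
  ultimately show ?thesis
    by (simp add: net_out_def sum_subtractf right_diff_distrib)
qed

lemma net_out_add_scaled: "net_out G (\<lambda>a. f a + c * d a) x = net_out G f x + c * net_out G d x"
proof -
  have "net_out G (\<lambda>a. f a + c * d a) x =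
      (\<Sum>a\<in>arcs G. f a * (of_bool (tail G a = x) - of_bool (head G a = x)) +
        c * (d a * (of_bool (tail G a = x) - of_bool (head G a = x))))"
    unfolding net_out_alt by (rule sum.cong) (simp_all only: distrib_right mult.assoc)
  then show ?thesis
    by (simp only: net_out_alt sum.distrib sum_distrib_left)
qed

lemma net_out_single:
  assumes "b \<in> arcs G"
  shows "net_out G (\<lambda>a. of_bool (a = b)) x = of_bool (x = tail G b) - of_bool (x = head G b)"
proof -
  have "net_out G (\<lambda>a. of_bool (a = b)) x =
      (\<Sum>a\<in>arcs G. if a = b then of_bool (tail G b = x) - of_bool (head G b = x) else 0)"
    unfolding net_out_alt by (rule sum.cong) auto
  then show ?thesis
    using assms by (auto simp: eq_commute)
qed

text \<open>An arc with both ends in \<open>C\<close> is counted once with each sign and cancels;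
  only arcs crossing the boundary survive.\<close>

lemma sum_net_out:
  assumes "C \<subseteq> verts G"
  shows "(\<Sum>x\<in>C. net_out G f x) = (\<Sum>a\<in>contributing_arcs G C. f a) - flow_in G f C"
proof -
  have C: "finite C"
    using assms finite_verts finite_subset by blast
  have "(\<Sum>x\<in>C. net_out G f x) =
      (\<Sum>a\<in>arcs G. f a * (\<Sum>x\<in>C. of_bool (tail G a = x) - of_bool (head G a = x)))"
    unfolding net_out_alt by (subst sum.swap) (simp add: sum_distrib_left)
  also have "\<dots> = (\<Sum>a\<in>arcs G. f a * (of_bool (tail G a \<in> C) - of_bool (head G a \<in> C)))"
    using C by (simp add: sum_subtractf of_bool_def)
  also have "\<dots> = (\<Sum>a\<in>arcs G. f a * of_bool (a \<in> contributing_arcs G C)) -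
      (\<Sum>a\<in>arcs G. f a * of_bool (tail G a \<in> verts G - C \<and> head G a \<in> C))"
    unfolding sum_subtractf[symmetric]
    by (rule sum.cong) (auto simp: contributing_arcs_def)
  also have "(\<Sum>a\<in>arcs G. f a * of_bool (a \<in> contributing_arcs G C)) =
      (\<Sum>a\<in>contributing_arcs G C. f a)"
    by (rule sum.mono_neutral_cong_right) (auto simp: contributing_arcs_def)
  also have "(\<Sum>a\<in>arcs G. f a * of_bool (tail G a \<in> verts G - C \<and> head G a \<in> C)) = flow_in G f C"
    unfolding flow_in_def by (rule sum.mono_neutral_cong_right) auto
  finally show ?thesis .
qed

text \<open>Since \<open>t\<close> lies outside \<open>C\<close>, conservation kills every term of
  \<open>sum_net_out\<close> except the one at \<open>s\<close>.\<close>

lemma flow_value_across_cut: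
  assumes f: "st_flow G w s t f" and C: "st_cut G s t C"
  shows "flow_value G s f = (\<Sum>a\<in>contributing_arcs G C. f a) - flow_in G f C"
proof -
  have "finite C"
    using C finite_verts by (auto simp: st_cut_def intro: finite_subset)
  moreover have "net_out G f x = 0" if "x \<in> C - {s}" for x
    using that f C by (auto simp: st_flow_iff_net_out st_cut_def)
  ultimately have "(\<Sum>x\<in>C. net_out G f x) = net_out G f s"
    using C by (simp add: sum.remove[of C s] st_cut_def)
  then show ?thesis
    using sum_net_out C by (simp add: st_cut_def flow_value_eq_net_out)
qed

lemma finite_contributing_arcs: "finite (contributing_arcs G C)"
  by (simp add: contributing_arcs_def)

lemma flow_in_nonneg: "st_flow G w s t f \<Longrightarrow> 0 \<le> flow_in G f C"
  by (auto simp: flow_in_def st_flow_def intro: sum_nonneg)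

lemma flow_out_le_cut_capacity:
  "st_flow G w s t f \<Longrightarrow> (\<Sum>a\<in>contributing_arcs G C. f a) \<le> cut_capacity G w C"
  by (auto simp: cut_capacity_def contributing_arcs_def st_flow_def intro: sum_mono)

lemma flow_value_le_cut_capacity:
  assumes "st_flow G w s t f" and "st_cut G s t C"
  shows "flow_value G s f \<le> cut_capacity G w C"
  using flow_value_across_cut[OF assms] flow_in_nonneg[OF assms(1)]
    flow_out_le_cut_capacity[OF assms(1)] by (smt (verit))

section \<open>Minimum cuts as attained minima\<close>

lemma finite_st_cuts: "finite {C. st_cut G s t C}"
  by (rule finite_subset[of _ "Pow (verts G)"]) (auto simp: st_cut_def)

lemma mincut_capacity_le: "st_cut G s t C \<Longrightarrow> mincut_capacity G w s t \<le> cut_capacity G w C"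
  unfolding mincut_capacity_def using finite_st_cuts by (intro Min_le) auto

lemma mincut_capacity_attained:
  assumes "s \<in> verts G" and "s \<noteq> t"
  obtains C where "st_cut G s t C" and "cut_capacity G w C = mincut_capacity G w s t"
proof -
  have "st_cut G s t {s}"
    using assms by (auto simp: st_cut_def)
  then have "mincut_capacity G w s t \<in> cut_capacity G w ` {C. st_cut G s t C}"
    unfolding mincut_capacity_def using finite_st_cuts by (intro Min_in) auto
  then show ?thesis
    using that by auto
qed

section \<open>Existence of a maximum flow by compactness\<close>

lemma max_st_flow_exists:
  assumes w: "\<forall>a\<in>arcs G. 0 \<le> w a"
  obtains f where "max_st_flow G w s t f"
proof -
  \<comment> \<open>The type of arcs may be infinite, so values off \<open>arcs G\<close> are pinned
    to 0; every factor is then compact and Tychonoff's theorem applies to the product.\<close>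
  define B where "B = PiE UNIV (\<lambda>a. if a \<in> arcs G then {0..w a} else {0})"
  define K where "K = B \<inter> (\<Inter>v\<in>verts G - {s, t}. {f. net_out G f v = 0})"
  have cont: "continuous_on UNIV (\<lambda>f. net_out G f v)" for v
    unfolding net_out_alt
    by (intro continuous_intros continuous_on_product_coordinates)
  have "compact B"
    unfolding B_def compactin_euclidean_iff[symmetric] euclidean_product_topology[symmetric]
    by (subst compactin_PiE) auto
  moreover have "closed {f. net_out G f v = 0}" for v
    using closed_Collect_eq[OF cont continuous_on_const] .
  ultimately have "compact K"
    unfolding K_def by (intro compact_Int_closed closed_INT) auto
  moreover have "(\<lambda>_. 0) \<in> K"
    using w by (auto simp: K_def B_def net_out_def)
  ultimately obtain f where f: "f \<in> K" and max: "\<And>g. g \<in> K \<Longrightarrow> net_out G g s \<le> net_out G f s"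
    using continuous_attains_sup[OF _ _ continuous_on_subset[OF cont[of s] subset_UNIV], of K]
    by auto
  have "\<forall>a\<in>arcs G. 0 \<le> f a \<and> f a \<le> w a"
  proof
    fix a assume "a \<in> arcs G"
    moreover have "f a \<in> (if a \<in> arcs G then {0..w a} else {0})"
      using f unfolding K_def B_def by (blast dest: PiE_mem)
    ultimately show "0 \<le> f a \<and> f a \<le> w a" by simp
  qed
  then have "st_flow G w s t f"
    using f by (auto simp: st_flow_iff_net_out K_def)
  moreover have "flow_value G s g \<le> flow_value G s f" if g: "st_flow G w s t g" for g
  proof -
    \<comment> \<open>An arbitrary flow need not vanish off \<open>arcs G\<close>. Truncating it
      changes no net outflow and brings it into \<open>K\<close>.\<close>
    define h where "h a = (if a \<in> arcs G then g a else 0)" for a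
    have eq: "net_out G h x = net_out G g x" for x
      unfolding net_out_alt by (rule sum.cong) (auto simp: h_def)
    have "h \<in> K"
      using g by (auto simp: K_def B_def eq st_flow_iff_net_out) (auto simp: h_def)
    then show ?thesis
      using max unfolding flow_value_eq_net_out eq[symmetric] by blast
  qed
  ultimately show ?thesis
    using that by (auto simp: max_st_flow_def)
qed

section \<open>Feasible directions and the max-flow min-cut theorem\<close>

lemma feasible_direction_step:
  assumes f: "\<forall>a\<in>arcs G. 0 \<le> f a \<and> f a \<le> w a" and d: "feasible_direction G w f d"
  obtains c where "0 < c" and "\<forall>a\<in>arcs G. 0 \<le> f a + c * d a \<and> f a + c * d a \<le> w a"
proof -
  \<comment> \<open>Each arc admits all sufficiently small positive steps; as there are finitely
    many arcs, a common step exists. A bound is kept by strict slack if \<open>d\<close> moves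
    towards it, and trivially otherwise.\<close>
  have "\<forall>a\<in>arcs G. eventually (\<lambda>c. 0 \<le> f a + c * d a \<and> f a + c * d a \<le> w a) (at_right 0)"
  proof
    fix a assume a: "a \<in> arcs G"
    have lim: "((\<lambda>c. f a + c * d a) \<longlongrightarrow> f a) (at_right 0)"
      by (auto intro!: tendsto_eq_intros)
    have pos: "eventually (\<lambda>c::real. 0 < c) (at_right 0)"
      by (rule eventually_at_right_less)
    have bounds: "0 \<le> f a" "f a \<le> w a"
      using f a by auto
    have "eventually (\<lambda>c. 0 \<le> f a + c * d a) (at_right 0)"
    proof (cases "d a < 0")
      case True
      then have "0 < f a"
        using d a by (auto simp: feasible_direction_def)
      from order_tendstoD(1)[OF lim this] show ?thesis
        by eventually_elim simp
    next
      case False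
      with pos bounds show ?thesis
        by (auto elim!: eventually_mono)
    qed
    moreover have "eventually (\<lambda>c. f a + c * d a \<le> w a) (at_right 0)"
    proof (cases "0 < d a")
      case True
      then have "f a < w a"
        using d a by (auto simp: feasible_direction_def)
      from order_tendstoD(2)[OF lim this] show ?thesis
        by eventually_elim simp
    next
      case False
      from pos show ?thesis
      proof eventually_elim
        case (elim c)
        then have "c * d a \<le> 0"
          using False by (simp add: mult_nonneg_nonpos)
        then show ?case
          using bounds by simp
      qed
    qed
    ultimately show "eventually (\<lambda>c. 0 \<le> f a + c * d a \<and> f a + c * d a \<le> w a) (at_right 0)"
      by (rule eventually_conj)
  qed
  then have "eventually (\<lambda>c. \<forall>a\<in>arcs G. 0 \<le> f a + c * d a \<and> f a + c * d a \<le> w a) (at_right 0)"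
    by (simp add: eventually_ball_finite_distrib)
  from eventually_conj[OF eventually_at_right_less this] show ?thesis
    using that by (auto dest!: eventually_happens)
qed

text \<open>A unit direction from \<open>s\<close> to \<open>t\<close>, scaled by a feasible step
  \<open>c\<close>, would raise the value of \<open>f\<close> by \<open>c\<close>.\<close>

lemma sink_notin_residual_cut:
  assumes max: "max_st_flow G w s t f" and "s \<noteq> t"
  shows "t \<notin> residual_cut G w s f"
proof
  assume "t \<in> residual_cut G w s f"
  then obtain d where d: "feasible_direction G w f d"
    and net: "\<And>x. net_out G d x = of_bool (x = s) - of_bool (x = t)"
    by (auto simp: residual_cut_def)
  from max have f: "st_flow G w s t f"
    by (simp add: max_st_flow_def)
  then have "\<forall>a\<in>arcs G. 0 \<le> f a \<and> f a \<le> w a"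
    by (simp add: st_flow_def)
  from feasible_direction_step[OF this d] obtain c where c: "0 < c"
    and bounds: "\<forall>a\<in>arcs G. 0 \<le> f a + c * d a \<and> f a + c * d a \<le> w a" .
  have "st_flow G w s t (\<lambda>a. f a + c * d a)"
    using f bounds by (auto simp: st_flow_iff_net_out net_out_add_scaled net)
  then have "net_out G (\<lambda>a. f a + c * d a) s \<le> net_out G f s"
    using max by (simp add: max_st_flow_def flow_value_eq_net_out)
  then show False
    using c \<open>s \<noteq> t\<close> by (simp add: net_out_add_scaled net)
qed

lemma residual_cut_saturated:
  assumes "a \<in> contributing_arcs G (residual_cut G w s f)"
  shows "w a \<le> f a"
proof (rule ccontr)
  assume slack: "\<not> w a \<le> f a"
  from assms obtain d where a: "a \<in> arcs G" and d: "feasible_direction G w f d"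
    and net: "\<And>x. net_out G d x = of_bool (x = s) - of_bool (x = tail G a)"
    by (auto simp: contributing_arcs_def residual_cut_def)
  \<comment> \<open>One more unit on \<open>a\<close> moves the end of the routing from the tail of
    \<open>a\<close> to its head; the slack on \<open>a\<close> keeps the direction
    feasible.\<close>
  let ?d = "\<lambda>b. d b + 1 * of_bool (b = a)"
  have "feasible_direction G w f ?d"
    using d slack by (auto simp: feasible_direction_def of_bool_def)
  moreover have "net_out G ?d x = of_bool (x = s) - of_bool (x = head G a)" for x
    using net[of x] net_out_single[OF a, of x] by (subst net_out_add_scaled) simp
  ultimately have "head G a \<in> residual_cut G w s f"
    unfolding residual_cut_def using head_in_verts[OF a] by blast
  with assms show False
    by (simp add: contributing_arcs_def)
qed

lemma residual_cut_no_inflow: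
  assumes a: "a \<in> arcs G" and "tail G a \<notin> residual_cut G w s f"
    and "head G a \<in> residual_cut G w s f"
  shows "f a \<le> 0"
proof (rule ccontr)
  assume pos: "\<not> f a \<le> 0"
  from assms obtain d where d: "feasible_direction G w f d"
    and net: "\<And>x. net_out G d x = of_bool (x = s) - of_bool (x = head G a)"
    by (auto simp: residual_cut_def)
  \<comment> \<open>Withdrawing a unit from \<open>a\<close> traverses it backwards, so the routing
    now ends at the tail; this is feasible because \<open>a\<close> carries positive flow.\<close>
  let ?d = "\<lambda>b. d b + (-1) * of_bool (b = a)"
  have "feasible_direction G w f ?d"
    using d pos by (auto simp: feasible_direction_def of_bool_def)
  moreover have "net_out G ?d x = of_bool (x = s) - of_bool (x = tail G a)" for x
    using net[of x] net_out_single[OF a, of x] by (subst net_out_add_scaled) simp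
  ultimately have "tail G a \<in> residual_cut G w s f"
    unfolding residual_cut_def using tail_in_verts[OF a] by blast
  with assms show False by simp
qed

text \<open>The residual cut is saturated and has no inflow, so its capacity is at most the value;
  weak duality against a minimum cut gives the converse.\<close>

lemma max_flow_value_eq_mincut_capacity:
  assumes max: "max_st_flow G w s t f" and "s \<in> verts G" and "s \<noteq> t"
  shows "flow_value G s f = mincut_capacity G w s t"
proof (rule antisym)
  let ?R = "residual_cut G w s f"
  from max have f: "st_flow G w s t f"
    by (simp add: max_st_flow_def)
  have "feasible_direction G w f (\<lambda>_. 0)"
    by (simp add: feasible_direction_def)
  moreover have "net_out G (\<lambda>_. 0) x = of_bool (x = s) - of_bool (x = s)" for x
    by (simp add: net_out_def)
  ultimately have "s \<in> ?R"
    unfolding residual_cut_def using \<open>s \<in> verts G\<close> by blast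
  then have R: "st_cut G s t ?R"
    using sink_notin_residual_cut[OF max \<open>s \<noteq> t\<close>] by (auto simp: st_cut_def residual_cut_def)
  have "flow_in G f ?R \<le> 0"
    unfolding flow_in_def by (rule sum_nonpos) (auto intro: residual_cut_no_inflow)
  moreover have "cut_capacity G w ?R \<le> (\<Sum>a\<in>contributing_arcs G ?R. f a)"
    unfolding cut_capacity_def by (intro sum_mono residual_cut_saturated)
  ultimately have "cut_capacity G w ?R \<le> flow_value G s f"
    using flow_value_across_cut[OF f R] by linarith
  then show "mincut_capacity G w s t \<le> flow_value G s f"
    using mincut_capacity_le[OF R, of w] by linarith
  obtain D where "st_cut G s t D" and "cut_capacity G w D = mincut_capacity G w s t"
    using mincut_capacity_attained \<open>s \<in> verts G\<close> \<open>s \<noteq> t\<close> by blast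
  then show "flow_value G s f \<le> mincut_capacity G w s t"
    using flow_value_le_cut_capacity[OF f] by metis
qed

lemma cut_tight_if_value_eq_capacity:
  assumes f: "st_flow G w s t f" and C: "st_cut G s t C"
    and val: "flow_value G s f = cut_capacity G w C"
  shows "flow_in G f C = 0" and "\<forall>a\<in>contributing_arcs G C. f a = w a"
proof -
  have "(\<Sum>a\<in>contributing_arcs G C. f a) = cut_capacity G w C" and in0: "flow_in G f C = 0"
    using flow_value_across_cut[OF f C] flow_in_nonneg[OF f, of C]
      flow_out_le_cut_capacity[OF f, of C] val by linarith+
  then have "(\<Sum>a\<in>contributing_arcs G C. w a - f a) = 0"
    by (simp add: sum_subtractf cut_capacity_def)
  moreover have "\<And>a. a \<in> contributing_arcs G C \<Longrightarrow> 0 \<le> w a - f a"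
    using f by (auto simp: st_flow_def contributing_arcs_def)
  ultimately show "\<forall>a\<in>contributing_arcs G C. f a = w a"
    using sum_nonneg_eq_0_iff[OF finite_contributing_arcs, of C "\<lambda>a. w a - f a"] by simp
  show "flow_in G f C = 0" by fact
qed

section \<open>Cut capacities after changing or deleting one arc\<close>

lemma cut_capacity_fun_upd:
  "cut_capacity G (w(e := c)) C =
     cut_capacity G w C - of_bool (e \<in> contributing_arcs G C) * (w e - c)"
proof (cases "e \<in> contributing_arcs G C")
  case True
  have "(\<Sum>a\<in>contributing_arcs G C - {e}. (w(e := c)) a) = (\<Sum>a\<in>contributing_arcs G C - {e}. w a)"
    by (rule sum.cong) auto
  then show ?thesis
    using True by (simp add: cut_capacity_def sum.remove[OF finite_contributing_arcs True])
next
  case False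
  then have "(\<Sum>a\<in>contributing_arcs G C. (w(e := c)) a) = (\<Sum>a\<in>contributing_arcs G C. w a)"
    by (intro sum.cong) auto
  with False show ?thesis
    by (simp add: cut_capacity_def)
qed

lemma cut_capacity_del_arc:
  "cut_capacity (del_arc e) w C =
     cut_capacity G w C - of_bool (e \<in> contributing_arcs G C) * w e"
proof -
  have "contributing_arcs (del_arc e) C = contributing_arcs G C - {e}"
    by (auto simp: contributing_arcs_def del_arc_def)
  then show ?thesis
    by (simp add: cut_capacity_def sum_diff1[OF finite_contributing_arcs])
qed

lemma st_cut_del_arc: "st_cut (del_arc e) s t C \<longleftrightarrow> st_cut G s t C"
  by (simp add: st_cut_def del_arc_def)

lemma mincut_capacity_del_arc_le:
  assumes "st_cut G s t C" and "e \<in> contributing_arcs G C"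
  shows "mincut_capacity (del_arc e) w s t \<le> cut_capacity G w C - w e"
proof -
  interpret D: fin_digraph "del_arc e" by (rule fin_digraph_del_arc)
  show ?thesis
    using D.mincut_capacity_le[of s t C w] assms
    by (simp add: st_cut_del_arc cut_capacity_del_arc)
qed

text \<open>The right-hand side bounds every cut through \<open>e\<close> from below by
  \<open>mincut_capacity_del_arc_le\<close>. Vitality makes the bound attained, by a minimum cut of
  the graph without \<open>e\<close>.\<close>

lemma mincut_for_iff_cut_capacity:
  assumes "s \<in> verts G" and "s \<noteq> t" and "vital G w s t e"
    and C: "st_cut G s t C" and e: "e \<in> contributing_arcs G C"
  shows "mincut_for G w s t e C \<longleftrightarrow> cut_capacity G w C = mincut_capacity (del_arc e) w s t + w e"
proof
  interpret D: fin_digraph "del_arc e" by (rule fin_digraph_del_arc)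
  have "s \<in> verts (del_arc e)"
    using assms by (simp add: del_arc_def)
  then obtain D where "st_cut (del_arc e) s t D"
    and capD: "cut_capacity (del_arc e) w D = mincut_capacity (del_arc e) w s t"
    using D.mincut_capacity_attained \<open>s \<noteq> t\<close> by blast
  then have D: "st_cut G s t D"
    by (simp add: st_cut_del_arc)
  \<comment> \<open>If \<open>e\<close> did not contribute to \<open>D\<close>, deleting it would
    leave the capacity of \<open>D\<close> unchanged, contradicting this strict inequality.\<close>
  have "mincut_capacity (del_arc e) w s t < cut_capacity G w D"
    using mincut_capacity_le[OF D, of w] \<open>vital G w s t e\<close> by (simp add: vital_def)
  then have eD: "e \<in> contributing_arcs G D"
    using capD by (cases "e \<in> contributing_arcs G D") (simp_all add: cut_capacity_del_arc)
  assume "mincut_for G w s t e C"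
  then have "cut_capacity G w C \<le> cut_capacity G w D"
    using D eD by (auto simp: mincut_for_def)
  then show "cut_capacity G w C = mincut_capacity (del_arc e) w s t + w e"
    using capD eD mincut_capacity_del_arc_le[OF C e, of w] by (simp add: cut_capacity_del_arc)
next
  assume "cut_capacity G w C = mincut_capacity (del_arc e) w s t + w e"
  then show "mincut_for G w s t e C"
    using mincut_capacity_del_arc_le[of s t _ e w] C e by (force simp: mincut_for_def)
qed

end

section \<open>Mincuts for a vital edge and saturating maximum flows\<close>

theorem theorem12:
  fixes G :: "('a, 'b) pre_digraph" and w :: "'b \<Rightarrow> real"
    and s t :: 'a and C :: "'a set" and e :: 'b
  assumes "fin_digraph G"
    and "s \<in> verts G" and "t \<in> verts G" and "s \<noteq> t"
    and "\<forall>a\<in>arcs G. 0 < w a"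
    and "st_cut G s t C"
    and "vital G w s t e"
    and "e \<in> contributing_arcs G C"
  shows "mincut_for G w s t e C \<longleftrightarrow>
    (\<exists>f. max_st_flow G w s t f \<and>
         flow_in G f C = 0 \<and>
         f e = w_min G w s t e \<and>
         (\<forall>e'\<in>contributing_arcs G C - {e}. f e' = w e'))"
proof -
  interpret fin_digraph G by fact
  note C = \<open>st_cut G s t C\<close> and e = \<open>e \<in> contributing_arcs G C\<close>
  let ?F = "mincut_capacity G w s t" and ?F' = "mincut_capacity (del_arc e) w s t"
  let ?w = "w(e := w_min G w s t e)"
  have F'_less: "?F' < ?F"
    using \<open>vital G w s t e\<close> by (simp add: vital_def)
  \<comment> \<open>Thus \<open>C\<close> has capacity \<open>?F\<close> under \<open>?w\<close>
    exactly when \<open>cut_capacity G w C = ?F' + w e\<close>; both directions rest on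
    this.\<close>
  have capC: "cut_capacity G ?w C = cut_capacity G w C - ?F' - w e + ?F"
    using e by (simp add: cut_capacity_fun_upd w_min_def)
  have "cut_capacity G w C = ?F' + w e \<longleftrightarrow>
    (\<exists>f. max_st_flow G w s t f \<and> flow_in G f C = 0 \<and> f e = w_min G w s t e \<and>
         (\<forall>e'\<in>contributing_arcs G C - {e}. f e' = w e'))" (is "_ \<longleftrightarrow> ?flow")
  proof
    assume eq: "cut_capacity G w C = ?F' + w e"
    then have w_le: "w_min G w s t e \<le> w e"
      using mincut_capacity_le[OF C, of w] by (simp add: w_min_def)
    \<comment> \<open>Cuts avoiding \<open>e\<close> keep their capacity, at least
      \<open>?F\<close>. A cut through \<open>e\<close> has capacity at least
      \<open>?F' + w e\<close> and loses \<open>w e - (?F - ?F')\<close>, which again leaves at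
      least \<open>?F\<close>.\<close>
    have cap_ge: "?F \<le> cut_capacity G ?w X" if X: "st_cut G s t X" for X
      using mincut_capacity_le[OF X, of w] mincut_capacity_del_arc_le[OF X, of e w]
      by (auto simp: cut_capacity_fun_upd w_min_def)
    have "\<forall>a\<in>arcs G. 0 \<le> ?w a"
      using \<open>\<forall>a\<in>arcs G. 0 < w a\<close> F'_less by (auto simp: w_min_def less_imp_le)
    then obtain f where f: "max_st_flow G ?w s t f"
      using max_st_flow_exists by blast
    then have flow': "st_flow G ?w s t f"
      by (simp add: max_st_flow_def)
    obtain D where D: "st_cut G s t D" "cut_capacity G ?w D = mincut_capacity G ?w s t"
      using mincut_capacity_attained[OF \<open>s \<in> verts G\<close> \<open>s \<noteq> t\<close>] by blast
    have "mincut_capacity G ?w s t = ?F"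
      using cap_ge[OF D(1)] D(2) mincut_capacity_le[OF C, of ?w] capC eq by simp
    then have val: "flow_value G s f = ?F"
      using max_flow_value_eq_mincut_capacity[OF f \<open>s \<in> verts G\<close> \<open>s \<noteq> t\<close>] by simp
    \<comment> \<open>Since \<open>?w\<close> lies below \<open>w\<close>, the flow \<open>f\<close>
      is also a flow for \<open>w\<close>. Its value \<open>?F\<close> is the minimum cut capacity
      for \<open>w\<close>, so it stays maximum there.\<close>
    have "f a \<le> w a" if "a \<in> arcs G" for a
      using flow' w_le that by (cases "a = e") (auto simp: st_flow_def)
    then have "st_flow G w s t f"
      using flow' by (auto simp: st_flow_def)
    moreover have "flow_value G s g \<le> ?F" if "st_flow G w s t g" for g
      using flow_value_le_cut_capacity[OF that]
        mincut_capacity_attained[OF \<open>s \<in> verts G\<close> \<open>s \<noteq> t\<close>, of w] by metis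
    ultimately have "max_st_flow G w s t f"
      using val by (simp add: max_st_flow_def)
    \<comment> \<open>Tightness is applied with \<open>?w\<close>: saturating \<open>e\<close> there
      means carrying exactly \<open>w_min G w s t e\<close>.\<close>
    moreover have "flow_value G s f = cut_capacity G ?w C"
      using val capC eq by simp
    from cut_tight_if_value_eq_capacity[OF flow' C this]
    have "flow_in G f C = 0" "\<forall>a\<in>contributing_arcs G C. f a = ?w a" .
    ultimately show ?flow
      using e by (intro exI[of _ f]) auto
  next
    assume ?flow
    then obtain f where f: "max_st_flow G w s t f" and in0: "flow_in G f C = 0"
      and fe: "f e = w_min G w s t e" and sat: "\<forall>e'\<in>contributing_arcs G C - {e}. f e' = w e'"
      by blast
    \<comment> \<open>The prescribed values of \<open>f\<close> on \<open>C\<close> are those of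
      \<open>?w\<close>. With no inflow, this sum is the value of \<open>f\<close>, hence
      \<open>?F\<close>, and \<open>capC\<close> yields the capacity of \<open>C\<close>.\<close>
    have "(\<Sum>a\<in>contributing_arcs G C. f a) = cut_capacity G ?w C"
      unfolding cut_capacity_def using fe sat by (intro sum.cong) auto
    moreover have "st_flow G w s t f"
      using f by (simp add: max_st_flow_def)
    ultimately have "flow_value G s f = cut_capacity G ?w C"
      using flow_value_across_cut[OF _ C] in0 by auto
    then show "cut_capacity G w C = ?F' + w e"
      using max_flow_value_eq_mincut_capacity[OF f \<open>s \<in> verts G\<close> \<open>s \<noteq> t\<close>] capC by simp
  qed
  then show ?thesis
    using mincut_for_iff_cut_capacity[OF \<open>s \<in> verts G\<close> \<open>s \<noteq> t\<close> \<open>vital G w s t e\<close> C e] by simp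
qed

end
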